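(* Let $f:\mathbb{R}^n\to\mathbb{R}$ be a $C^2$ function which is convex over a box $$B=\{(u_1,\ldots,u_n)\in\mathbb{R}^n : (b_i^+-u_i)(u_i-b_i^-)\ge0,\ i=1,\ldots,n\}.$$ For any $\epsilon>0$, there exist an integer $d$ and a polynomial $p$ of degree $d$ such that $$\max_{x\in B}|f(x)-p(x)|<\epsilon$$ and such that $p$ is also convex over $B$. Furthermore, convexity of $p$ over $B$ can be certified using a sum of squares certificate.
   Context: Here $b_i^-\le b_i^+$ are real numbers. A function $f$ is convex over $B$ if $f(\lambda x+(1-\lambda)y)\le\lambda f(x)+(1-\lambda)f(y)$ for all $x,y\in B$, $\lambda\in(0,1)$ (equivalently, for twice-differentiable $f$, its Hessian is positive semidefinite on $B$). A sum of squares certificate of convexity over $B$ of a polynomial $p$ with Hessian $H_p$ is an identity $$y^TH_p(x)y=\sigma_0(x,y)+\sum_{k=1}^n\sigma_k(x,y)(b_k^+-x_k)(x_k-b_k^-)$$ in the variables $(x,y)\in\mathbb{R}^n\times\mathbb{R}^n$, where $\sigma_0,\ldots,\sigma_n$ are sums of squares of polynomials that are quadratic in $y$. *)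

theory Defs
  imports "HOL-Analysis.Analysis" "HOL-Library.Poly_Mapping"
begin

text \<open>Real polynomials in variables from \<open>'v\<close>: finitely supported maps from monomials
  (exponent vectors) to coefficients. Ring operations, in particular products, are those of
  \<open>Poly_Mapping\<close>.\<close>

type_synonym 'v monomial = "'v \<Rightarrow>\<^sub>0 nat"
type_synonym 'v rpoly = "'v monomial \<Rightarrow>\<^sub>0 real"

definition poly_eval :: "'v rpoly \<Rightarrow> ('v \<Rightarrow> real) \<Rightarrow> real" where
  "poly_eval p a =
     (\<Sum>m\<in>Poly_Mapping.keys p. Poly_Mapping.lookup p m *
        (\<Prod>v\<in>Poly_Mapping.keys m. a v ^ Poly_Mapping.lookup m v))"

definition monomial_degree :: "'v monomial \<Rightarrow> nat" where
  "monomial_degree m = (\<Sum>v\<in>Poly_Mapping.keys m. Poly_Mapping.lookup m v)"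

text \<open>The zero polynomial gets degree \<open>0\<close>.\<close>

definition total_degree :: "'v rpoly \<Rightarrow> nat" where
  "total_degree p = Max (insert 0 (monomial_degree ` Poly_Mapping.keys p))"

definition sum_of_squares :: "'v rpoly \<Rightarrow> bool" where
  "sum_of_squares s \<longleftrightarrow> (\<exists>qs :: 'v rpoly list. s = (\<Sum>q\<leftarrow>qs. q ^ 2))"

text \<open>Variables \<open>Inl i\<close> stand for \<open>x\<^sub>i\<close> and \<open>Inr i\<close> for \<open>y\<^sub>i\<close>. Quadratic in \<open>y\<close> means being a
  quadratic form in \<open>y\<close> with coefficients polynomial in \<open>x\<close> (possibly zero).\<close>

definition quadratic_in_y :: "('n::finite + 'n) rpoly \<Rightarrow> bool" where
  "quadratic_in_y s \<longleftrightarrow>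
     (\<forall>m\<in>Poly_Mapping.keys s. (\<Sum>i\<in>UNIV. Poly_Mapping.lookup m (Inr i)) = 2)"

definition poly_fun :: "'n::finite rpoly \<Rightarrow> real ^ 'n \<Rightarrow> real" where
  "poly_fun p x = poly_eval p (\<lambda>i. x $ i)"

definition poly_fun2 :: "('n::finite + 'n) rpoly \<Rightarrow> real ^ 'n \<Rightarrow> real ^ 'n \<Rightarrow> real" where
  "poly_fun2 s x y = poly_eval s (case_sum (\<lambda>i. x $ i) (\<lambda>i. y $ i))"

text \<open>\<open>H x\<close> is the Jacobian matrix at \<open>x\<close> of the gradient field of \<open>f\<close>.\<close>

definition has_hessian :: "(real ^ 'n::finite \<Rightarrow> real) \<Rightarrow> (real ^ 'n \<Rightarrow> real ^ 'n ^ 'n) \<Rightarrow> bool" where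
  "has_hessian f H \<longleftrightarrow>
     (\<exists>g. \<forall>x. GDERIV f x :> g x \<and> (g has_derivative (\<lambda>h. H x *v h)) (at x))"

lemma has_hessian_unique:
  assumes "has_hessian f H" "has_hessian f K"
  shows "H = K"
proof
  fix x
  obtain g where g: "\<And>x. GDERIV f x :> g x" "\<And>x. (g has_derivative (\<lambda>h. H x *v h)) (at x)"
    using assms(1) unfolding has_hessian_def by blast
  obtain k where k: "\<And>x. GDERIV f x :> k x" "\<And>x. (k has_derivative (\<lambda>h. K x *v h)) (at x)"
    using assms(2) unfolding has_hessian_def by blast
  have "g z = k z" for z
  proof -
    have "(\<lambda>h. h \<bullet> g z) = (\<lambda>h. h \<bullet> k z)"
      using g(1)[of z] k(1)[of z] unfolding gderiv_def by (rule has_derivative_unique)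
    then show ?thesis by (metis vector_eq_ldot)
  qed
  then have "g = k" by blast
  then have "(\<lambda>h. H x *v h) = (\<lambda>h. K x *v h)"
    using g(2)[of x] k(2)[of x] by (metis has_derivative_unique)
  then show "H x = K x" by (metis matrix_eq)
qed

definition C2_function :: "(real ^ 'n::finite \<Rightarrow> real) \<Rightarrow> bool" where
  "C2_function f \<longleftrightarrow> (\<exists>H. has_hessian f H \<and> continuous_on UNIV H)"

definition coord_box :: "real ^ 'n::finite \<Rightarrow> real ^ 'n \<Rightarrow> (real ^ 'n) set" where
  "coord_box bl bu = {u. \<forall>i. (bu $ i - u $ i) * (u $ i - bl $ i) \<ge> 0}"

definition sos_convexity_certificate ::
    "real ^ 'n::finite \<Rightarrow> real ^ 'n \<Rightarrow> 'n rpoly \<Rightarrow> bool" where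
  "sos_convexity_certificate bl bu p \<longleftrightarrow>
     (\<exists>H s0 s. has_hessian (poly_fun p) H \<and>
        sum_of_squares s0 \<and> quadratic_in_y s0 \<and>
        (\<forall>k. sum_of_squares (s k) \<and> quadratic_in_y (s k)) \<and>
        (\<forall>x y. y \<bullet> (H x *v y) =
           poly_fun2 s0 x y +
           (\<Sum>k\<in>UNIV. poly_fun2 (s k) x y * ((bu $ k - x $ k) * (x $ k - bl $ k)))))"

end

theory Submission
  imports Defs
begin

text \<open>
  Approximation of \<open>f\<close> in the \<open>C\<^sup>2\<close> sense would leave a positive definite matrix polynomial to be
  certified, which calls for a matrix Positivstellensatz. Uniform approximation leaves enough
  freedom to choose a \<open>p\<close> whose certificate can be written down.

  On the box \<open>B\<close> the convex function \<open>f\<close> is the supremum of its tangent planes, and by compactness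
  finitely many of them suffice up to a small error (\<open>finitely_many_tangents\<close>). After adding a
  constant they become affine functions \<open>l\<^sub>t \<ge> 1\<close>, and their maximum is close to the power norm
  \<open>(\<Sum>\<^sub>t l\<^sub>t\<^sup>N)\<^bsup>1/N\<^esup>\<close> with \<open>N\<close> even and large (\<open>power_mean_max\<close>). Only the outer root is not a
  polynomial. Scale the \<open>l\<^sub>t\<close> so that \<open>z = 1 - \<Sum>\<^sub>t l\<^sub>t\<^sup>N\<close> is nonnegative on \<open>B\<close>, and replace
  \<open>(1 - z)\<^sup>\<alpha>\<close>, where \<open>\<alpha> = 1/N\<close>, by a truncation \<open>T(z)\<close> of its Taylor series (\<open>root_trunc\<close>). As
  \<open>l\<^sub>t \<ge> 1\<close> keeps \<open>z\<close> away from \<open>1\<close>, the series converges uniformly on \<open>B\<close>.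

  For the certificate put \<open>U = - T'\<close>, \<open>V = - T''\<close> and \<open>w\<^sub>t = y \<bullet> \<nabla>l\<^sub>t\<close>. The chain rule gives
  \<open>N\<^sup>2 ((1 - \<alpha>) U(z) \<Sum> l\<^sub>t\<^bsup>N-2\<^esup> w\<^sub>t\<^sup>2 - V(z) (\<Sum> l\<^sub>t\<^bsup>N-1\<^esup> w\<^sub>t)\<^sup>2)\<close> as the Hessian form of \<open>T(z(x))\<close>.
  The function \<open>(1 - z)\<^sup>\<alpha>\<close> itself satisfies \<open>(1 - \<alpha>) U = (1 - z) V\<close>, and truncation adds one monomial
  with nonnegative coefficient to the right side (\<open>root_trunc_ode\<close>). Since \<open>1 - z = \<Sum> l\<^sub>t\<^sup>N\<close>,
  Lagrange's identity writes
  \<open>(1 - z) \<Sum> l\<^sub>t\<^bsup>N-2\<^esup> w\<^sub>t\<^sup>2 - (\<Sum> l\<^sub>t\<^bsup>N-1\<^esup> w\<^sub>t)\<^sup>2\<close> as a sum of squares. Hence the Hessian form is a combination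
  of products \<open>z\<^sup>i \<cdot> (sum of squares)\<close> with nonnegative coefficients (\<open>certified_hessian\<close>). Finally,
  \<open>z\<close> and its powers lie in the quadratic module generated by the polynomials
  \<open>(b\<^sub>k\<^sup>+ - x\<^sub>k) (x\<^sub>k - b\<^sub>k\<^sup>-)\<close>, because this module is Archimedean (\<open>certified_bounded_polynomial\<close>).
\<close>

section \<open>Evaluation of polynomials\<close>

lemma poly_eval_superset:
  fixes p :: "'v::finite rpoly"
  assumes "finite S" "Poly_Mapping.keys p \<subseteq> S"
  shows "poly_eval p a =
    (\<Sum>m\<in>S. Poly_Mapping.lookup p m * (\<Prod>v\<in>UNIV. a v ^ Poly_Mapping.lookup m v))"
proof -
  have "(\<Prod>v\<in>Poly_Mapping.keys m. a v ^ Poly_Mapping.lookup m v) =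
      (\<Prod>v\<in>UNIV. a v ^ Poly_Mapping.lookup m v)" for m :: "'v monomial"
    by (rule prod.mono_neutral_left) (auto simp: in_keys_iff)
  then have "poly_eval p a = (\<Sum>m\<in>Poly_Mapping.keys p.
      Poly_Mapping.lookup p m * (\<Prod>v\<in>UNIV. a v ^ Poly_Mapping.lookup m v))"
    unfolding poly_eval_def by simp
  also have "\<dots> = (\<Sum>m\<in>S. Poly_Mapping.lookup p m * (\<Prod>v\<in>UNIV. a v ^ Poly_Mapping.lookup m v))"
    by (rule sum.mono_neutral_left) (use assms in \<open>auto simp: in_keys_iff\<close>)
  finally show ?thesis .
qed

lemma poly_eval_single:
  fixes m :: "'v::finite monomial"
  shows "poly_eval (Poly_Mapping.single m c) a =
    c * (\<Prod>v\<in>UNIV. a v ^ Poly_Mapping.lookup m v)"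
  by (subst poly_eval_superset[of "{m}"]) auto

lemma poly_eval_zero: "poly_eval 0 a = 0"
  by (simp add: poly_eval_def)

lemma poly_eval_add:
  fixes p q :: "'v::finite rpoly"
  shows "poly_eval (p + q) a = poly_eval p a + poly_eval q a"
proof -
  let ?S = "Poly_Mapping.keys p \<union> Poly_Mapping.keys q"
  show ?thesis
    by (simp add: poly_eval_superset[of ?S] keys_add lookup_add algebra_simps sum.distrib)
qed

lemma poly_eval_sum:
  fixes p :: "'i \<Rightarrow> 'v::finite rpoly"
  shows "poly_eval (\<Sum>i\<in>I. p i) a = (\<Sum>i\<in>I. poly_eval (p i) a)"
  by (induction I rule: infinite_finite_induct) (auto simp: poly_eval_zero poly_eval_add)

lemma sum_single_lookup:
  "(\<Sum>m\<in>Poly_Mapping.keys p. Poly_Mapping.single m (Poly_Mapping.lookup p m)) = p"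
proof (rule poly_mapping_eqI)
  fix m
  show "Poly_Mapping.lookup (\<Sum>m\<in>Poly_Mapping.keys p.
      Poly_Mapping.single m (Poly_Mapping.lookup p m)) m = Poly_Mapping.lookup p m"
    by (simp add: lookup_sum lookup_single when_def in_keys_iff)
qed

lemma poly_eval_mult:
  fixes p q :: "'v::finite rpoly"
  shows "poly_eval (p * q) a = poly_eval p a * poly_eval q a"
proof -
  let ?s = "\<lambda>p m. Poly_Mapping.single m (Poly_Mapping.lookup p m)"
  have "poly_eval (p * q) a = poly_eval ((\<Sum>m\<in>Poly_Mapping.keys p. ?s p m) *
      (\<Sum>n\<in>Poly_Mapping.keys q. ?s q n)) a"
    by (simp only: sum_single_lookup)
  also have "\<dots> = (\<Sum>m\<in>Poly_Mapping.keys p. \<Sum>n\<in>Poly_Mapping.keys q.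
      poly_eval (?s p m) a * poly_eval (?s q n) a)"
    by (simp add: sum_product poly_eval_sum mult_single poly_eval_single lookup_add
        power_add prod.distrib mult_ac)
  also have "\<dots> = poly_eval (\<Sum>m\<in>Poly_Mapping.keys p. ?s p m) a *
      poly_eval (\<Sum>n\<in>Poly_Mapping.keys q. ?s q n) a"
    by (simp only: poly_eval_sum sum_product)
  finally show ?thesis
    by (simp only: sum_single_lookup)
qed

definition const_poly :: "real \<Rightarrow> 'v rpoly" where
  "const_poly c = Poly_Mapping.single 0 c"

definition var_poly :: "'v \<Rightarrow> 'v rpoly" where
  "var_poly v = Poly_Mapping.single (Poly_Mapping.single v 1) 1"

lemma keys_const_poly: "Poly_Mapping.keys (const_poly c) \<subseteq> {0}"
  by (simp add: const_poly_def)

lemma keys_var_poly: "Poly_Mapping.keys (var_poly v) = {Poly_Mapping.single v 1}"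
  by (simp add: var_poly_def)

lemma poly_eval_const: "poly_eval (const_poly c) a = (c :: real)"
  for a :: "'v::finite \<Rightarrow> real"
  by (simp add: const_poly_def poly_eval_single)

lemma poly_eval_var: "poly_eval (var_poly v) a = a v"
  for a :: "'v::finite \<Rightarrow> real"
proof -
  have "(\<Prod>w\<in>UNIV. a w ^ Poly_Mapping.lookup (Poly_Mapping.single v (1::nat)) w) =
      (\<Prod>w\<in>{v}. a w ^ Poly_Mapping.lookup (Poly_Mapping.single v (1::nat)) w)"
    by (rule prod.mono_neutral_right) (auto simp: lookup_single when_def)
  then show ?thesis
    by (simp add: var_poly_def poly_eval_single)
qed

lemma bounded_linear_vec_sum:
  fixes l :: "real ^ 'n \<Rightarrow> real"
  assumes "bounded_linear l"
  shows "l x = (\<Sum>i\<in>UNIV. l (axis i 1) * x $ i)"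
proof -
  have "l x = l (\<Sum>i\<in>UNIV. x $ i *\<^sub>R axis i 1)"
    using basis_expansion[of x] by (simp add: scalar_mult_eq_scaleR)
  also have "\<dots> = (\<Sum>i\<in>UNIV. x $ i *\<^sub>R l (axis i 1))"
    using assms by (simp add: bounded_linear.linear linear_sum linear_cmul)
  finally show ?thesis by (simp add: mult.commute)
qed

lemma poly_fun_representation:
  fixes F :: "real ^ 'n::finite \<Rightarrow> real"
  assumes "real_polynomial_function F"
  shows "\<exists>p. poly_fun p = F"
  using assms
proof (induction rule: real_polynomial_function.induct)
  case (linear l)
  have "poly_fun (\<Sum>i\<in>UNIV. const_poly (l (axis i 1)) * var_poly i) = l"
    by (rule ext) (simp add: poly_fun_def poly_eval_sum poly_eval_mult poly_eval_const
        poly_eval_var bounded_linear_vec_sum[OF linear, symmetric])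
  then show ?case by blast
next
  case (const c)
  have "poly_fun (const_poly c) = (\<lambda>x. c)"
    by (rule ext) (simp add: poly_fun_def poly_eval_const)
  then show ?case by blast
next
  case (add f g)
  then obtain p q where "poly_fun p = f" "poly_fun q = g" by blast
  then have "poly_fun (p + q) = (\<lambda>x. f x + g x)"
    by (auto simp: poly_fun_def poly_eval_add fun_eq_iff)
  then show ?case by blast
next
  case (mult f g)
  then obtain p q where "poly_fun p = f" "poly_fun q = g" by blast
  then have "poly_fun (p * q) = (\<lambda>x. f x * g x)"
    by (auto simp: poly_fun_def poly_eval_mult fun_eq_iff)
  then show ?case by blast
qed

section \<open>Forms in y and sums of squares\<close>

definition y_degree :: "('n::finite + 'n) monomial \<Rightarrow> nat" where
  "y_degree m = (\<Sum>i\<in>UNIV. Poly_Mapping.lookup m (Inr i))"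

text \<open>Polynomials in \<open>(x, y)\<close> are handled as functions. \<open>y_form d F\<close> says that \<open>F\<close> is homogeneous of
  degree \<open>d\<close> in \<open>y\<close> with coefficients polynomial in \<open>x\<close>. Recording \<open>d\<close> lets one calculus serve both the
  multipliers in \<open>x\<close> (\<open>d = 0\<close>) and the linear forms in \<open>y\<close> (\<open>d = 1\<close>), whose squares are quadratic
  in \<open>y\<close>.\<close>

definition y_form :: "nat \<Rightarrow> (real ^ 'n::finite \<Rightarrow> real ^ 'n \<Rightarrow> real) \<Rightarrow> bool" where
  "y_form d F \<longleftrightarrow>
     (\<exists>q. (\<forall>m\<in>Poly_Mapping.keys q. y_degree m = d) \<and> poly_fun2 q = F)"

lemma quadratic_in_y_iff:
  "quadratic_in_y s \<longleftrightarrow> (\<forall>m\<in>Poly_Mapping.keys s. y_degree m = 2)"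
  by (simp add: quadratic_in_y_def y_degree_def)

lemma y_degree_add: "y_degree (m + n) = y_degree m + y_degree n"
  by (simp add: y_degree_def lookup_add sum.distrib)

lemma y_degree_keys_mult:
  assumes "\<forall>m\<in>Poly_Mapping.keys p. y_degree m = d" "\<forall>m\<in>Poly_Mapping.keys q. y_degree m = e"
  shows "\<forall>m\<in>Poly_Mapping.keys (p * q). y_degree m = d + e"
proof
  fix m assume "m \<in> Poly_Mapping.keys (p * q)"
  then obtain m1 m2 where "m = m1 + m2" "m1 \<in> Poly_Mapping.keys p" "m2 \<in> Poly_Mapping.keys q"
    using keys_mult[of p q] by auto
  then show "y_degree m = d + e"
    using assms by (simp add: y_degree_add)
qed

lemma y_degree_keys_add:
  assumes "\<forall>m\<in>Poly_Mapping.keys p. y_degree m = d" "\<forall>m\<in>Poly_Mapping.keys q. y_degree m = d"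
  shows "\<forall>m\<in>Poly_Mapping.keys (p + q). y_degree m = d"
  using assms keys_add[of p q] by blast

lemma y_form_zero: "y_form d (\<lambda>x y. 0)"
  unfolding y_form_def by (rule exI[of _ 0]) (auto simp: poly_fun2_def poly_eval_zero fun_eq_iff)

lemma y_form_const: "y_form 0 (\<lambda>x y. c)"
proof -
  have "\<forall>m\<in>Poly_Mapping.keys (const_poly c). y_degree m = 0"
    using keys_const_poly by (force simp: y_degree_def)
  moreover have "poly_fun2 (const_poly c) = (\<lambda>x y. c)"
    by (simp add: poly_fun2_def poly_eval_const fun_eq_iff)
  ultimately show ?thesis unfolding y_form_def by blast
qed

lemma y_form_x: "y_form 0 (\<lambda>x y. x $ i)"
proof -
  have "\<forall>m\<in>Poly_Mapping.keys (var_poly (Inl i)). y_degree m = 0"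
    by (simp add: keys_var_poly y_degree_def lookup_single)
  moreover have "poly_fun2 (var_poly (Inl i)) = (\<lambda>x y. x $ i)"
    by (simp add: poly_fun2_def poly_eval_var fun_eq_iff)
  ultimately show ?thesis unfolding y_form_def by blast
qed

lemma y_form_y: "y_form 1 (\<lambda>x y. y $ i)"
proof -
  have "\<forall>m\<in>Poly_Mapping.keys (var_poly (Inr i)). y_degree m = 1"
    by (simp add: keys_var_poly y_degree_def lookup_single when_def)
  moreover have "poly_fun2 (var_poly (Inr i)) = (\<lambda>x y. y $ i)"
    by (simp add: poly_fun2_def poly_eval_var fun_eq_iff)
  ultimately show ?thesis unfolding y_form_def by blast
qed

lemma y_form_add:
  assumes "y_form d F" "y_form d G"
  shows "y_form d (\<lambda>x y. F x y + G x y)"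
proof -
  from assms obtain p q where
    p: "\<forall>m\<in>Poly_Mapping.keys p. y_degree m = d" "poly_fun2 p = F" and
    q: "\<forall>m\<in>Poly_Mapping.keys q. y_degree m = d" "poly_fun2 q = G"
    unfolding y_form_def by blast
  have "poly_fun2 (p + q) = (\<lambda>x y. F x y + G x y)"
    using p(2) q(2) by (auto simp: poly_fun2_def poly_eval_add fun_eq_iff)
  with y_degree_keys_add[OF p(1) q(1)] show ?thesis
    unfolding y_form_def by blast
qed

lemma y_form_mult:
  assumes "y_form d F" "y_form e G"
  shows "y_form (d + e) (\<lambda>x y. F x y * G x y)"
proof -
  from assms obtain p q where
    p: "\<forall>m\<in>Poly_Mapping.keys p. y_degree m = d" "poly_fun2 p = F" and
    q: "\<forall>m\<in>Poly_Mapping.keys q. y_degree m = e" "poly_fun2 q = G"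
    unfolding y_form_def by blast
  have "poly_fun2 (p * q) = (\<lambda>x y. F x y * G x y)"
    using p(2) q(2) by (auto simp: poly_fun2_def poly_eval_mult fun_eq_iff)
  with y_degree_keys_mult[OF p(1) q(1)] show ?thesis
    unfolding y_form_def by blast
qed

lemma y_form_sum:
  assumes "\<And>i. i \<in> I \<Longrightarrow> y_form d (F i)"
  shows "y_form d (\<lambda>x y. \<Sum>i\<in>I. F i x y)"
  using assms
  by (induction I rule: infinite_finite_induct) (auto simp: y_form_zero y_form_add)

lemma y_form_diff:
  assumes "y_form d F" "y_form d G"
  shows "y_form d (\<lambda>x y. F x y - G x y)"
proof -
  have "y_form d (\<lambda>x y. - 1 * G x y)"
    using y_form_mult[OF y_form_const[of "-1"] assms(2)] by simp
  from y_form_add[OF assms(1) this] show ?thesis by simp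
qed

lemma y_form_polynomial:
  assumes "real_polynomial_function q"
  shows "y_form 0 (\<lambda>x y. q x)"
  using assms
proof (induction rule: real_polynomial_function.induct)
  case (linear l)
  have "y_form 0 (\<lambda>x y. \<Sum>i\<in>UNIV. l (axis i 1) * x $ i)"
    using y_form_mult[OF y_form_const y_form_x] by (intro y_form_sum) simp
  then show ?case
    by (simp add: bounded_linear_vec_sum[OF linear, symmetric])
next
  case (const c)
  then show ?case by (rule y_form_const)
next
  case (add f g)
  then show ?case by (intro y_form_add)
next
  case (mult f g)
  then show ?case using y_form_mult[of 0 "\<lambda>x y. f x" 0 "\<lambda>x y. g x"] by simp
qed

lemma y_form_inner: "y_form 1 (\<lambda>x y. a \<bullet> y)"
proof -
  have "y_form 1 (\<lambda>x y. \<Sum>i\<in>UNIV. a $ i * y $ i)"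
    using y_form_mult[OF y_form_const y_form_y] by (intro y_form_sum) simp
  then show ?thesis by (simp add: inner_vec_def)
qed

inductive sos_form :: "nat \<Rightarrow> (real ^ 'n::finite \<Rightarrow> real ^ 'n \<Rightarrow> real) \<Rightarrow> bool" for d where
  zero: "sos_form d (\<lambda>x y. 0)"
| add_square: "y_form d q \<Longrightarrow> sos_form d F \<Longrightarrow> sos_form d (\<lambda>x y. (q x y)\<^sup>2 + F x y)"

lemma sos_form_square: "y_form d q \<Longrightarrow> sos_form d (\<lambda>x y. (q x y)\<^sup>2)"
  using sos_form.add_square[OF _ sos_form.zero] by force

lemma sos_form_add:
  assumes "sos_form d F" "sos_form d G"
  shows "sos_form d (\<lambda>x y. F x y + G x y)"
  using assms(1)
proof induction
  case zero
  then show ?case using assms(2) by simp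
next
  case (add_square q F)
  then show ?case
    using sos_form.add_square[of d q "\<lambda>x y. F x y + G x y"] by (simp add: add.assoc)
qed

lemma sos_form_sum:
  assumes "\<And>i. i \<in> I \<Longrightarrow> sos_form d (F i)"
  shows "sos_form d (\<lambda>x y. \<Sum>i\<in>I. F i x y)"
  using assms
  by (induction I rule: infinite_finite_induct) (auto simp: sos_form.zero sos_form_add)

lemma sos_form_mult_square:
  assumes "y_form d q" "sos_form e F"
  shows "sos_form (d + e) (\<lambda>x y. (q x y)\<^sup>2 * F x y)"
  using assms(2)
proof induction
  case zero
  then show ?case by (simp add: sos_form.zero)
next
  case (add_square r F)
  then show ?case
    using sos_form.add_square[OF y_form_mult[OF assms(1) add_square(1)] add_square.IH]
    by (simp add: algebra_simps power_mult_distrib)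
qed

lemma sos_form_mult:
  assumes "sos_form d F" "sos_form e G"
  shows "sos_form (d + e) (\<lambda>x y. F x y * G x y)"
  using assms(1)
proof induction
  case zero
  then show ?case by (simp add: sos_form.zero)
next
  case (add_square q F)
  then show ?case
    using sos_form_add[OF sos_form_mult_square[OF add_square(1) assms(2)] add_square.IH]
    by (simp add: algebra_simps)
qed

lemma sos_form_const: "c \<ge> 0 \<Longrightarrow> sos_form 0 (\<lambda>x y. c)"
  using sos_form_square[OF y_form_const[of "sqrt c"]] by simp

lemma sos_form_nonneg: "sos_form d F \<Longrightarrow> F x y \<ge> 0"
  by (induction rule: sos_form.induct) auto

text \<open>This is where the calculus of functions returns to polynomials as formal objects.\<close>

lemma sos_form_representation:
  assumes "sos_form 1 F"
  shows "\<exists>s. sum_of_squares s \<and> quadratic_in_y s \<and> poly_fun2 s = F"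
  using assms
proof induction
  case zero
  have "sum_of_squares 0"
    unfolding sum_of_squares_def by (rule exI[of _ "[]"]) simp
  then show ?case
    by (intro exI[of _ 0]) (auto simp: quadratic_in_y_def poly_fun2_def poly_eval_zero fun_eq_iff)
next
  case (add_square q F)
  then obtain s qs where s: "s = (\<Sum>q\<leftarrow>qs. q ^ 2)" "quadratic_in_y s" "poly_fun2 s = F"
    unfolding sum_of_squares_def by blast
  from add_square(1) obtain r where
    r: "\<forall>m\<in>Poly_Mapping.keys r. y_degree m = 1" "poly_fun2 r = q"
    unfolding y_form_def by blast
  have "sum_of_squares (r ^ 2 + s)"
    unfolding sum_of_squares_def using s(1) by (intro exI[of _ "r # qs"]) simp
  moreover have "quadratic_in_y (r ^ 2 + s)"
    unfolding quadratic_in_y_iff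
  proof (rule y_degree_keys_add)
    show "\<forall>m\<in>Poly_Mapping.keys (r ^ 2). y_degree m = 2"
      using y_degree_keys_mult[OF r(1) r(1)] unfolding power2_eq_square by simp
    show "\<forall>m\<in>Poly_Mapping.keys s. y_degree m = 2"
      using s(2) unfolding quadratic_in_y_iff .
  qed
  moreover have "poly_fun2 (r ^ 2 + s) = (\<lambda>x y. (q x y)\<^sup>2 + F x y)"
    using r(2) s(3) by (auto simp: poly_fun2_def poly_eval_add poly_eval_mult power2_eq_square fun_eq_iff)
  ultimately show ?case by blast
qed

section \<open>The quadratic module of the box\<close>

text \<open>The quadratic module of the box, graded: the members for \<open>d\<close> are homogeneous of degree \<open>2 * d\<close> in
  \<open>y\<close>. For \<open>d = 1\<close> membership of the Hessian form is the certificate sought. Products of two of the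
  box polynomials need not belong to the module, so closure under products is available for
  sum of squares factors only.\<close>

definition certified ::
    "real ^ 'n::finite \<Rightarrow> real ^ 'n \<Rightarrow> nat \<Rightarrow> (real ^ 'n \<Rightarrow> real ^ 'n \<Rightarrow> real) \<Rightarrow> bool" where
  "certified bl bu d F \<longleftrightarrow>
     (\<exists>F0 Fk. sos_form d F0 \<and> (\<forall>k. sos_form d (Fk k)) \<and>
        F = (\<lambda>x y. F0 x y + (\<Sum>k\<in>UNIV. Fk k x y * ((bu $ k - x $ k) * (x $ k - bl $ k)))))"

lemma certified_sos: "sos_form d F \<Longrightarrow> certified bl bu d F"
  unfolding certified_def
  by (intro exI[of _ F] exI[of _ "\<lambda>k x y. 0"]) (auto simp: sos_form.zero)

lemma certified_generator:
  fixes bl bu :: "real ^ 'n::finite"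
  shows "certified bl bu 0 (\<lambda>x y. (bu $ k - x $ k) * (x $ k - bl $ k))"
proof -
  let ?S = "\<lambda>j (x :: real ^ 'n) (y :: real ^ 'n). if j = k then 1 else 0 :: real"
  have "sos_form 0 (?S j)" for j
    using sos_form_const[of 1] sos_form.zero by (cases "j = k") simp_all
  moreover have "(\<Sum>j\<in>UNIV. ?S j x y * ((bu $ j - x $ j) * (x $ j - bl $ j))) =
      (bu $ k - x $ k) * (x $ k - bl $ k)" for x y
    by (simp add: if_distrib[where f="\<lambda>t. t * _"] cong: if_cong)
  ultimately show ?thesis
    unfolding certified_def
    by (intro exI[of _ "\<lambda>x y. 0"] exI[of _ ?S]) (simp add: sos_form.zero)
qed

lemma certified_add:
  assumes "certified bl bu d F" "certified bl bu d G"
  shows "certified bl bu d (\<lambda>x y. F x y + G x y)"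
proof -
  from assms obtain F0 Fk G0 Gk where
    "sos_form d F0" "\<forall>k. sos_form d (Fk k)"
    "F = (\<lambda>x y. F0 x y + (\<Sum>k\<in>UNIV. Fk k x y * ((bu $ k - x $ k) * (x $ k - bl $ k))))"
    "sos_form d G0" "\<forall>k. sos_form d (Gk k)"
    "G = (\<lambda>x y. G0 x y + (\<Sum>k\<in>UNIV. Gk k x y * ((bu $ k - x $ k) * (x $ k - bl $ k))))"
    unfolding certified_def by blast
  then show ?thesis
    unfolding certified_def
    by (intro exI[of _ "\<lambda>x y. F0 x y + G0 x y"] exI[of _ "\<lambda>k x y. Fk k x y + Gk k x y"])
      (simp add: sos_form_add sum.distrib distrib_right add_ac)
qed

lemma certified_sum:
  assumes "\<And>i. i \<in> I \<Longrightarrow> certified bl bu d (F i)"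
  shows "certified bl bu d (\<lambda>x y. \<Sum>i\<in>I. F i x y)"
  using assms
  by (induction I rule: infinite_finite_induct)
    (auto simp: certified_sos sos_form.zero certified_add)

lemma certified_sos_mult:
  assumes "sos_form d S" "certified bl bu e F"
  shows "certified bl bu (d + e) (\<lambda>x y. S x y * F x y)"
proof -
  from assms(2) obtain F0 Fk where
    F: "sos_form e F0" "\<forall>k. sos_form e (Fk k)"
    "F = (\<lambda>x y. F0 x y + (\<Sum>k\<in>UNIV. Fk k x y * ((bu $ k - x $ k) * (x $ k - bl $ k))))"
    unfolding certified_def by blast
  then show ?thesis
    unfolding certified_def
    by (intro exI[of _ "\<lambda>x y. S x y * F0 x y"] exI[of _ "\<lambda>k x y. S x y * Fk k x y"])
      (auto simp: sos_form_mult assms(1) distrib_left sum_distrib_left mult.assoc)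
qed

lemma certified_scale:
  assumes "c \<ge> 0" "certified bl bu d F"
  shows "certified bl bu d (\<lambda>x y. c * F x y)"
  using certified_sos_mult[OF sos_form_const[OF assms(1)] assms(2)] by simp

lemma certified_nonneg:
  assumes "certified bl bu d F" "x \<in> coord_box bl bu"
  shows "F x y \<ge> 0"
proof -
  from assms(1) obtain F0 Fk where
    F: "sos_form d F0" "\<And>k. sos_form d (Fk k)"
    "F = (\<lambda>x y. F0 x y + (\<Sum>k\<in>UNIV. Fk k x y * ((bu $ k - x $ k) * (x $ k - bl $ k))))"
    unfolding certified_def by blast
  have "Fk k x y * ((bu $ k - x $ k) * (x $ k - bl $ k)) \<ge> 0" for k
    using assms(2) sos_form_nonneg[OF F(2)] by (simp add: coord_box_def)
  then show ?thesis
    unfolding F(3) by (intro add_nonneg_nonneg sum_nonneg sos_form_nonneg[OF F(1)])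
qed

text \<open>The module is in general not closed under products, but \<open>z\<^sup>i\<^sup>+\<^sup>2\<close> arises from \<open>z\<^sup>i\<close> by multiplication with a
  square.\<close>

lemma certified_power:
  assumes "real_polynomial_function z" "certified bl bu 0 (\<lambda>x y. z x)"
  shows "certified bl bu 0 (\<lambda>x y. z x ^ i)"
proof (induction i rule: induct_nat_012)
  case 0
  then show ?case by (simp add: certified_sos sos_form_const)
next
  case 1
  then show ?case using assms(2) by simp
next
  case (ge2 i)
  then show ?case
    using certified_sos_mult[OF sos_form_square[OF y_form_polynomial[OF assms(1)]] ge2(1)]
    by (simp add: power2_eq_square mult.assoc)
qed

text \<open>The elements whose square is bounded modulo the quadratic module. They are closed under sums
  and products, and the coordinates are among them because
  \<open>(b\<^sup>+ - x) (x - b\<^sup>-) = r\<^sup>2 - (x - c)\<^sup>2\<close> for the midpoint \<open>c\<close> and the half length \<open>r\<close> of the interval. Therefore all polynomials are bounded: the module is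
  Archimedean.\<close>

definition certified_bounded ::
    "real ^ 'n::finite \<Rightarrow> real ^ 'n \<Rightarrow> (real ^ 'n \<Rightarrow> real) \<Rightarrow> bool" where
  "certified_bounded bl bu q \<longleftrightarrow> real_polynomial_function q \<and>
     (\<exists>C\<ge>0. certified bl bu 0 (\<lambda>x y. C - (q x)\<^sup>2))"

lemma certified_bounded_const: "certified_bounded bl bu (\<lambda>x. c)"
  unfolding certified_bounded_def
  by (auto intro!: exI[of _ "c\<^sup>2"] certified_sos sos_form.zero real_polynomial_function.intros(2))

text \<open>By the parallelogram law \<open>2 (C - p\<^sup>2) + 2 (D - q\<^sup>2) + (p - q)\<^sup>2 = 2 (C + D) - (p + q)\<^sup>2\<close>.\<close>

lemma certified_bounded_add:
  assumes "certified_bounded bl bu p" "certified_bounded bl bu q"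
  shows "certified_bounded bl bu (\<lambda>x. p x + q x)"
proof -
  from assms obtain C D where
    p: "real_polynomial_function p" "C \<ge> 0" "certified bl bu 0 (\<lambda>x y. C - (p x)\<^sup>2)" and
    q: "real_polynomial_function q" "D \<ge> 0" "certified bl bu 0 (\<lambda>x y. D - (q x)\<^sup>2)"
    unfolding certified_bounded_def by blast
  have "y_form 0 (\<lambda>x y. p x - q x)"
    using y_form_diff[OF y_form_polynomial[OF p(1)] y_form_polynomial[OF q(1)]] .
  then have "certified bl bu 0 (\<lambda>x y. (p x - q x)\<^sup>2)"
    by (intro certified_sos sos_form_square)
  from certified_add[OF certified_scale[OF _ certified_add[OF p(3) q(3)], of 2] this]
  have "certified bl bu 0 (\<lambda>x y. 2 * (C + D) - (p x + q x)\<^sup>2)"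
    by (simp add: power2_eq_square algebra_simps)
  then show ?thesis
    unfolding certified_bounded_def using p q by (intro conjI exI[of _ "2 * (C + D)"]) auto
qed

text \<open>By the identity \<open>q\<^sup>2 (C - p\<^sup>2) + C (D - q\<^sup>2) = C D - (p q)\<^sup>2\<close>.\<close>

lemma certified_bounded_mult:
  assumes "certified_bounded bl bu p" "certified_bounded bl bu q"
  shows "certified_bounded bl bu (\<lambda>x. p x * q x)"
proof -
  from assms obtain C D where
    p: "real_polynomial_function p" "C \<ge> 0" "certified bl bu 0 (\<lambda>x y. C - (p x)\<^sup>2)" and
    q: "real_polynomial_function q" "D \<ge> 0" "certified bl bu 0 (\<lambda>x y. D - (q x)\<^sup>2)"
    unfolding certified_bounded_def by blast
  have "certified bl bu 0 (\<lambda>x y. (q x)\<^sup>2 * (C - (p x)\<^sup>2))"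
    using certified_sos_mult[OF sos_form_square[OF y_form_polynomial[OF q(1)]] p(3)] by simp
  from certified_add[OF this certified_scale[OF p(2) q(3)]]
  have "certified bl bu 0 (\<lambda>x y. C * D - (p x * q x)\<^sup>2)"
    by (simp add: algebra_simps power_mult_distrib)
  then show ?thesis
    unfolding certified_bounded_def using p q by (intro conjI exI[of _ "C * D"]) auto
qed

lemma certified_bounded_component:
  fixes bl bu :: "real ^ 'n::finite"
  shows "certified_bounded bl bu (\<lambda>x. x $ k)"
proof -
  define c r where "c = (bl $ k + bu $ k) / 2" and "r = (bu $ k - bl $ k) / 2"
  have "(bu $ k - x $ k) * (x $ k - bl $ k) = r\<^sup>2 - (x $ k - c)\<^sup>2" for x :: "real ^ 'n"
    by (simp add: c_def r_def power2_eq_square field_simps)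
  then have "certified bl bu 0 (\<lambda>x y. r\<^sup>2 - (x $ k - c)\<^sup>2)"
    using certified_generator[of bl bu k] by simp
  moreover have "real_polynomial_function (\<lambda>x. x $ k - c)"
    by (intro real_polynomial_function_diff real_polynomial_function.intros(1)
        real_polynomial_function.intros(2) bounded_linear_vec_nth)
  ultimately have "certified_bounded bl bu (\<lambda>x. x $ k - c)"
    unfolding certified_bounded_def by (auto intro!: exI[of _ "r\<^sup>2"])
  from certified_bounded_add[OF this certified_bounded_const[of bl bu c]]
  show ?thesis by simp
qed

lemma certified_bounded_polynomial:
  assumes "real_polynomial_function q"
  shows "certified_bounded bl bu q"
  using assms
proof (induction rule: real_polynomial_function.induct)
  case (linear l)
  have "certified_bounded bl bu (\<lambda>x. \<Sum>i\<in>I. l (axis i 1) * x $ i)" if "finite I" for I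
    using that
    by (induction I)
      (simp_all add: certified_bounded_const certified_bounded_add certified_bounded_mult
        certified_bounded_component)
  from this[of UNIV] show ?case
    by (simp add: bounded_linear_vec_sum[OF linear, symmetric])
next
  case (const c)
  then show ?case by (rule certified_bounded_const)
next
  case (add f g)
  then show ?case by (intro certified_bounded_add)
next
  case (mult f g)
  then show ?case by (intro certified_bounded_mult)
qed

section \<open>Truncated root series\<close>

text \<open>The Taylor coefficients at \<open>0\<close> of \<open>\<alpha> (1 - z)\<^bsup>\<alpha>-1\<^esup>\<close>, minus the derivative of \<open>(1 - z)\<^sup>\<alpha>\<close>. They
  are nonnegative for \<open>0 \<le> \<alpha> \<le> 1\<close>, which is what makes the certificate work.\<close>

definition root_coeff :: "real \<Rightarrow> nat \<Rightarrow> real" where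
  "root_coeff \<alpha> i = \<alpha> * pochhammer (1 - \<alpha>) i / fact i"

definition root_trunc :: "real \<Rightarrow> nat \<Rightarrow> real \<Rightarrow> real" where
  "root_trunc \<alpha> K z = 1 - (\<Sum>i<K. root_coeff \<alpha> i / real (Suc i) * z ^ Suc i)"

text \<open>Minus the first and minus the second derivative of the truncation. The change of sign makes all
  coefficients nonnegative.\<close>

definition root_trunc' :: "real \<Rightarrow> nat \<Rightarrow> real \<Rightarrow> real" where
  "root_trunc' \<alpha> K z = (\<Sum>i<K. root_coeff \<alpha> i * z ^ i)"

definition root_trunc'' :: "real \<Rightarrow> nat \<Rightarrow> real \<Rightarrow> real" where
  "root_trunc'' \<alpha> K z = (\<Sum>i<K. root_coeff \<alpha> i * (real i * z ^ (i - 1)))"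

lemma root_coeff_nonneg: "0 \<le> \<alpha> \<Longrightarrow> \<alpha> \<le> 1 \<Longrightarrow> 0 \<le> root_coeff \<alpha> i"
  by (simp add: root_coeff_def pochhammer_nonneg pochhammer_prod prod_nonneg)

lemma root_coeff_Suc: "real (Suc i) * root_coeff \<alpha> (Suc i) = (real (Suc i) - \<alpha>) * root_coeff \<alpha> i"
proof -
  have "1 - \<alpha> + real i = real (Suc i) - \<alpha>" by simp
  then show ?thesis
    by (simp add: root_coeff_def pochhammer_Suc del: of_nat_Suc)
qed

lemma DERIV_root_trunc: "(root_trunc \<alpha> K has_real_derivative - root_trunc' \<alpha> K z) (at z)"
proof -
  have "((\<lambda>z. root_coeff \<alpha> i / real (Suc i) * z ^ Suc i) has_real_derivative
      root_coeff \<alpha> i * z ^ i) (at z)" for i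
    by (rule derivative_eq_intros refl | simp)+
  then have "((\<lambda>z. \<Sum>i<K. root_coeff \<alpha> i / real (Suc i) * z ^ Suc i) has_real_derivative
      root_trunc' \<alpha> K z) (at z)"
    unfolding root_trunc'_def by (intro DERIV_sum)
  from DERIV_diff[OF DERIV_const this, of 1] show ?thesis
    by (simp add: root_trunc_def[abs_def])
qed

lemma DERIV_root_trunc': "(root_trunc' \<alpha> K has_real_derivative root_trunc'' \<alpha> K z) (at z)"
proof -
  have "((\<lambda>z. root_coeff \<alpha> i * z ^ i) has_real_derivative
      root_coeff \<alpha> i * (real i * z ^ (i - 1))) (at z)" for i
    by (rule derivative_eq_intros refl | simp)+
  then show ?thesis
    unfolding root_trunc'_def[abs_def] root_trunc''_def by (intro DERIV_sum)
qed

text \<open>The truncated form of the differential equation \<open>(1 - \<alpha>) U = (1 - z) V\<close> of \<open>(1 - z)\<^sup>\<alpha>\<close>, with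
  \<open>U\<close> and \<open>V\<close> its first and second derivatives up to sign. Below the top
  degree the coefficients cancel by the recursion \<open>root_coeff_Suc\<close>; the single term that is left
  has a nonnegative coefficient if \<open>0 \<le> \<alpha> \<le> 1\<close>.\<close>

lemma root_trunc_ode:
  "(1 - \<alpha>) * root_trunc' \<alpha> K z - (1 - z) * root_trunc'' \<alpha> K z =
     real K * root_coeff \<alpha> K * z ^ (K - 1)"
proof (induction K)
  case 0
  then show ?case by (simp add: root_trunc'_def root_trunc''_def)
next
  case (Suc K)
  let ?e = "root_coeff \<alpha> K"
  have *: "(1 - \<alpha>) * root_trunc' \<alpha> (Suc K) z - (1 - z) * root_trunc'' \<alpha> (Suc K) z =
      real K * ?e * z ^ (K - 1) + (1 - \<alpha>) * ?e * z ^ K - (1 - z) * ?e * real K * z ^ (K - 1)"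
    using Suc.IH by (simp add: root_trunc'_def root_trunc''_def algebra_simps)
  also have "\<dots> = ?e * ((1 - \<alpha>) * z ^ K + real K * z ^ K)"
    by (cases K) (simp_all add: algebra_simps)
  also have "\<dots> = real (Suc K) * root_coeff \<alpha> (Suc K) * z ^ K"
    by (simp only: root_coeff_Suc) (simp add: algebra_simps)
  finally show ?case by simp
qed

lemma root_series:
  assumes "\<bar>z\<bar> < 1"
  shows "(\<lambda>i. root_coeff \<alpha> i / real (Suc i) * z ^ Suc i) sums (1 - (1 - z) powr \<alpha>)"
proof -
  have "(\<lambda>n. (\<alpha> gchoose n) * (- z) ^ n) sums (1 - z) powr \<alpha>"
    using gen_binomial_real[of "- z" \<alpha>] assms by simp
  then have "(\<lambda>i. (\<alpha> gchoose Suc i) * (- z) ^ Suc i) sums ((1 - z) powr \<alpha> - 1)"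
    by (subst sums_Suc_iff) simp
  from sums_minus[OF this]
  have "(\<lambda>i. - ((\<alpha> gchoose Suc i) * (- z) ^ Suc i)) sums (1 - (1 - z) powr \<alpha>)"
    by simp
  moreover have "- ((\<alpha> gchoose Suc i) * (- z) ^ Suc i) =
      root_coeff \<alpha> i / real (Suc i) * z ^ Suc i" for i
  proof -
    have "(\<alpha> gchoose Suc i) = (-1) ^ Suc i * (- \<alpha> * pochhammer (1 - \<alpha>) i) / fact (Suc i)"
      by (simp add: gbinomial_pochhammer pochhammer_rec del: fact_Suc)
    moreover have "(- z) ^ Suc i = (-1) ^ Suc i * z ^ Suc i"
      by (rule power_minus)
    ultimately show ?thesis
      by (simp add: root_coeff_def field_simps flip: power_mult_distrib)
  qed
  ultimately show ?thesis by simp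
qed

text \<open>The remainder is a power series with nonnegative coefficients, so on \<open>[0, r]\<close> it is largest at
  \<open>r\<close>, where it tends to \<open>0\<close>.\<close>

lemma root_trunc_approximates:
  assumes "0 \<le> \<alpha>" "\<alpha> \<le> 1" "0 \<le> r" "r < 1" "\<delta> > 0"
  shows "\<exists>K. \<forall>z\<in>{0..r}. \<bar>root_trunc \<alpha> K z - (1 - z) powr \<alpha>\<bar> \<le> \<delta>"
proof -
  define t where "t z i = root_coeff \<alpha> i / real (Suc i) * z ^ Suc i" for z i
  have sums: "t z sums (1 - (1 - z) powr \<alpha>)" if "z \<in> {0..r}" for z
    unfolding t_def using that assms by (intro root_series) auto
  have tail: "root_trunc \<alpha> K z - (1 - z) powr \<alpha> = suminf (\<lambda>i. t z (i + K))" if "z \<in> {0..r}" for z K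
    using suminf_minus_initial_segment[OF sums_summable[OF sums[OF that]], of K]
      sums_unique[OF sums[OF that]]
    by (simp add: root_trunc_def t_def[abs_def])
  have coeff: "root_coeff \<alpha> i / real (Suc i) \<ge> 0" for i
    using root_coeff_nonneg[OF assms(1,2)] by simp
  have nonneg: "t z i \<ge> 0" and mono: "t z i \<le> t r i" if "z \<in> {0..r}" for z i
    unfolding t_def using that
    by (intro mult_nonneg_nonneg mult_left_mono power_mono zero_le_power coeff; simp)+
  have summable: "summable (\<lambda>i. t z (i + K))" if "z \<in> {0..r}" for z K
    using sums_summable[OF sums[OF that]] by (rule summable_ignore_initial_segment)
  have "r \<in> {0..r}" using assms(3) by simp
  from suminf_exist_split[OF assms(5) sums_summable[OF sums[OF this]]]
  obtain K where "norm (suminf (\<lambda>i. t r (i + K))) < \<delta>" by blast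
  then have K: "suminf (\<lambda>i. t r (i + K)) \<le> \<delta>" by simp
  have "\<bar>root_trunc \<alpha> K z - (1 - z) powr \<alpha>\<bar> \<le> \<delta>" if z: "z \<in> {0..r}" for z
  proof -
    have "0 \<le> suminf (\<lambda>i. t z (i + K))"
      using nonneg[OF z] summable[OF z] by (intro suminf_nonneg)
    moreover have "suminf (\<lambda>i. t z (i + K)) \<le> suminf (\<lambda>i. t r (i + K))"
      using mono[OF z] summable[OF z] summable[of r] assms(3) by (intro suminf_le) auto
    ultimately show ?thesis
      using K tail[OF z] by simp
  qed
  then show ?thesis by blast
qed

section \<open>Hessians\<close>

text \<open>The second order chain rule for \<open>T(1 - \<Sum>\<^sub>j l\<^sub>j\<^sup>N)\<close> with \<open>N = 2 * m + 2\<close>. Each \<open>l\<^sub>j\<close> is affine, so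
  second derivatives come only from the powers and from \<open>T\<close>.\<close>

lemma hessian_composite:
  fixes a :: "'i \<Rightarrow> real ^ 'n::finite" and b :: "'i \<Rightarrow> real" and J :: "'i set" and m :: nat
  defines "l \<equiv> \<lambda>j x. a j \<bullet> x + b j"
  defines "z \<equiv> \<lambda>x. 1 - (\<Sum>j\<in>J. l j x ^ (2 * m + 2))"
  assumes T: "\<And>t. (T has_real_derivative - U t) (at t)"
    and U: "\<And>t. (U has_real_derivative V t) (at t)"
  shows "\<exists>H. has_hessian (\<lambda>x. A * T (z x) + C) H \<and>
    (\<forall>x y. y \<bullet> (H x *v y) = A *
      (real (2 * m + 2) * real (2 * m + 1) * U (z x) * (\<Sum>j\<in>J. l j x ^ (2 * m) * (a j \<bullet> y)\<^sup>2) -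
       (real (2 * m + 2))\<^sup>2 * V (z x) * (\<Sum>j\<in>J. l j x ^ (2 * m + 1) * (a j \<bullet> y))\<^sup>2))"
proof -
  define N where "N = real (2 * m + 2)"
  \<comment> \<open>\<open>g\<close> is the gradient, \<open>L x\<close> its derivative at \<open>x\<close>, and \<open>- N * D x\<close> the derivative of \<open>z\<close>.\<close>
  define g where "g x = (\<Sum>j\<in>J. (A * N * U (z x) * l j x ^ (2 * m + 1)) *\<^sub>R a j)" for x
  define D where "D x h = (\<Sum>j\<in>J. l j x ^ (2 * m + 1) * (a j \<bullet> h))" for x h
  define L where "L x h = (\<Sum>j\<in>J. (A * N * (U (z x) * (real (2 * m + 1) * l j x ^ (2 * m) * (a j \<bullet> h))
      - N * V (z x) * D x h * l j x ^ (2 * m + 1))) *\<^sub>R a j)" for x h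
  have l: "(l j has_derivative (\<lambda>h. a j \<bullet> h)) (at x)" for j x
    unfolding l_def by (auto intro!: derivative_eq_intros)
  have lpow: "((\<lambda>x. l j x ^ Suc n) has_derivative (\<lambda>h. real (Suc n) * l j x ^ n * (a j \<bullet> h))) (at x)"
    for j x n
    by (rule has_derivative_eq_rhs[OF has_derivative_power[OF l]]) (auto simp: fun_eq_iff mult_ac)
  have z: "(z has_derivative (\<lambda>h. - (N * D x h))) (at x)" for x
  proof -
    have "((\<lambda>x. 1 - (\<Sum>j\<in>J. l j x ^ Suc (2 * m + 1))) has_derivative
        (\<lambda>h. 0 - (\<Sum>j\<in>J. real (Suc (2 * m + 1)) * l j x ^ (2 * m + 1) * (a j \<bullet> h)))) (at x)"
      by (intro has_derivative_diff has_derivative_const has_derivative_sum lpow)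
    moreover have "(\<lambda>x. 1 - (\<Sum>j\<in>J. l j x ^ Suc (2 * m + 1))) = z"
      by (simp add: z_def)
    moreover have "(\<lambda>h. 0 - (\<Sum>j\<in>J. real (Suc (2 * m + 1)) * l j x ^ (2 * m + 1) * (a j \<bullet> h))) =
        (\<lambda>h. - (N * D x h))"
      by (simp add: D_def N_def sum_distrib_left mult.assoc add_ac)
    ultimately show ?thesis by simp
  qed
  have Tz: "((\<lambda>x. T (z x)) has_derivative (\<lambda>h. N * U (z x) * D x h)) (at x)" for x
    using has_derivative_compose[OF z T[unfolded has_field_derivative_def], of x]
    by (simp add: mult_ac)
  have Uz: "((\<lambda>x. U (z x)) has_derivative (\<lambda>h. - (N * V (z x) * D x h))) (at x)" for x
    using has_derivative_compose[OF z U[unfolded has_field_derivative_def], of x]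
    by (simp add: mult_ac)
  have grad: "GDERIV (\<lambda>x. A * T (z x) + C) x :> g x" for x
  proof -
    have "((\<lambda>x. A * T (z x) + C) has_derivative (\<lambda>h. A * (N * U (z x) * D x h) + 0)) (at x)"
      by (intro has_derivative_add has_derivative_mult_right has_derivative_const Tz)
    moreover have "(\<lambda>h. A * (N * U (z x) * D x h) + 0) = (\<lambda>h. h \<bullet> g x)"
      by (simp add: g_def D_def inner_sum_right sum_distrib_left inner_commute mult_ac)
    ultimately show ?thesis unfolding gderiv_def by simp
  qed
  have hess: "(g has_derivative L x) (at x)" for x
  proof -
    have "((\<lambda>x. A * N * (U (z x) * l j x ^ Suc (2 * m))) has_derivative
        (\<lambda>h. A * N * (U (z x) * (real (Suc (2 * m)) * l j x ^ (2 * m) * (a j \<bullet> h)) +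
          - (N * V (z x) * D x h) * l j x ^ Suc (2 * m)))) (at x)" for j
      by (intro has_derivative_mult_right has_derivative_mult Uz lpow)
    then have "((\<lambda>x. \<Sum>j\<in>J. (A * N * (U (z x) * l j x ^ Suc (2 * m))) *\<^sub>R a j) has_derivative
        (\<lambda>h. \<Sum>j\<in>J. (A * N * (U (z x) * (real (Suc (2 * m)) * l j x ^ (2 * m) * (a j \<bullet> h)) +
          - (N * V (z x) * D x h) * l j x ^ Suc (2 * m))) *\<^sub>R a j)) (at x)"
      by (intro has_derivative_sum has_derivative_scaleR_left)
    moreover have "(\<lambda>x. \<Sum>j\<in>J. (A * N * (U (z x) * l j x ^ Suc (2 * m))) *\<^sub>R a j) = g"
      by (simp add: g_def[abs_def] mult.assoc)
    moreover have "(\<lambda>h. \<Sum>j\<in>J. (A * N * (U (z x) * (real (Suc (2 * m)) * l j x ^ (2 * m) * (a j \<bullet> h)) +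
          - (N * V (z x) * D x h) * l j x ^ Suc (2 * m))) *\<^sub>R a j) = L x"
      by (simp add: L_def[abs_def])
    ultimately show ?thesis by simp
  qed
  have L: "(*v) (matrix (L x)) = L x" for x
    using has_derivative_bounded_linear[OF hess] by simp
  have "has_hessian (\<lambda>x. A * T (z x) + C) (\<lambda>x. matrix (L x))"
    unfolding has_hessian_def using grad hess by (intro exI[of _ g]) (simp add: L)
  moreover have "y \<bullet> L x y = A * (N * real (2 * m + 1) * U (z x) * (\<Sum>j\<in>J. l j x ^ (2 * m) * (a j \<bullet> y)\<^sup>2) -
       N\<^sup>2 * V (z x) * (D x y)\<^sup>2)" for x y
  proof -
    have "y \<bullet> L x y = (\<Sum>j\<in>J. A * N * real (2 * m + 1) * U (z x) * (l j x ^ (2 * m) * (a j \<bullet> y)\<^sup>2) -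
        A * N\<^sup>2 * V (z x) * D x y * (l j x ^ (2 * m + 1) * (a j \<bullet> y)))"
      unfolding L_def inner_sum_right
      by (rule sum.cong) (simp_all add: inner_commute power2_eq_square algebra_simps)
    also have "\<dots> = A * N * real (2 * m + 1) * U (z x) * (\<Sum>j\<in>J. l j x ^ (2 * m) * (a j \<bullet> y)\<^sup>2) -
        A * N\<^sup>2 * V (z x) * D x y * D x y"
      by (simp add: sum_subtractf D_def sum_distrib_left)
    finally show ?thesis by (simp add: power2_eq_square algebra_simps)
  qed
  ultimately show ?thesis
    by (intro exI[of _ "\<lambda>x. matrix (L x)"]) (simp add: L N_def D_def)
qed

lemma lagrange_identity:
  fixes u v :: "'i \<Rightarrow> real"
  shows "(\<Sum>i\<in>J. (u i)\<^sup>2) * (\<Sum>i\<in>J. (v i)\<^sup>2) - (\<Sum>i\<in>J. u i * v i)\<^sup>2 =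
    1 / 2 * (\<Sum>i\<in>J. \<Sum>j\<in>J. (u i * v j - u j * v i)\<^sup>2)"
proof -
  have "(\<Sum>i\<in>J. \<Sum>j\<in>J. (u i * v j - u j * v i)\<^sup>2) =
      (\<Sum>i\<in>J. \<Sum>j\<in>J. (u i)\<^sup>2 * (v j)\<^sup>2) + (\<Sum>i\<in>J. \<Sum>j\<in>J. (v i)\<^sup>2 * (u j)\<^sup>2)
      - 2 * (\<Sum>i\<in>J. \<Sum>j\<in>J. (u i * v i) * (u j * v j))"
    by (simp add: power2_eq_square algebra_simps sum.distrib sum_subtractf sum_distrib_left)
  also have "\<dots> = 2 * ((\<Sum>i\<in>J. (u i)\<^sup>2) * (\<Sum>i\<in>J. (v i)\<^sup>2) - (\<Sum>i\<in>J. u i * v i)\<^sup>2)"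
    by (simp add: power2_eq_square[of "sum _ _"] mult.commute[of "sum (\<lambda>i. (v i)\<^sup>2) J"] flip: sum_product)
  finally show ?thesis by simp
qed

text \<open>The differential equation turns the positive part of the Hessian form into \<open>V(z) (1 - z)\<close> times
  \<open>\<Sum> l\<^sub>j\<^bsup>N-2\<^esup> w\<^sub>j\<^sup>2\<close>, plus a term with a power of \<open>z\<close>. Now \<open>1 - z = \<Sum> l\<^sub>j\<^sup>N\<close>, so what remains after
  subtracting the negative part \<open>V(z) (\<Sum> l\<^sub>j\<^bsup>N-1\<^esup> w\<^sub>j)\<^sup>2\<close> is \<open>V(z)\<close> times the defect in the
  Cauchy-Schwarz inequality for \<open>u\<^sub>j = l\<^sub>j\<^bsup>N/2\<^esup>\<close> and \<open>v\<^sub>j = l\<^sub>j\<^bsup>N/2-1\<^esup> w\<^sub>j\<close>, a sum of squares by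
  Lagrange's identity.\<close>

lemma certified_hessian:
  fixes a :: "'i \<Rightarrow> real ^ 'n::finite" and b :: "'i \<Rightarrow> real" and J :: "'i set" and m :: nat
  defines "l \<equiv> \<lambda>j x. a j \<bullet> x + b j"
  defines "z \<equiv> \<lambda>x. 1 - (\<Sum>j\<in>J. l j x ^ (2 * m + 2))"
  assumes z: "certified bl bu 0 (\<lambda>x y. z x)" and "finite J" "A \<ge> 0"
  shows "\<exists>H. has_hessian (\<lambda>x. A * root_trunc (1 / real (2 * m + 2)) K (z x) + C) H \<and>
    certified bl bu 1 (\<lambda>x y. y \<bullet> (H x *v y))"
proof -
  define N where "N = real (2 * m + 2)"
  define \<alpha> where "\<alpha> = 1 / N"
  have \<alpha>: "0 \<le> \<alpha>" "\<alpha> \<le> 1" and N: "N > 0" by (simp_all add: \<alpha>_def N_def)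
  let ?U = "root_trunc' \<alpha> K" and ?V = "root_trunc'' \<alpha> K"
  \<comment> \<open>\<open>Q\<close> is \<open>\<Sum> v\<^sub>j\<^sup>2\<close>, and \<open>W\<close> is twice the Cauchy-Schwarz defect of \<open>u\<close> and \<open>v\<close>.\<close>
  define Q where "Q x y = (\<Sum>j\<in>J. (l j x ^ m * (a j \<bullet> y))\<^sup>2)" for x y
  define W where "W x y = (\<Sum>i\<in>J. \<Sum>j\<in>J. (l i x ^ Suc m * (l j x ^ m * (a j \<bullet> y)) -
      l j x ^ Suc m * (l i x ^ m * (a i \<bullet> y)))\<^sup>2)" for x y
  obtain H where H: "has_hessian (\<lambda>x. A * root_trunc \<alpha> K (z x) + C) H"
    "\<And>x y. y \<bullet> (H x *v y) = A *
      (real (2 * m + 2) * real (2 * m + 1) * ?U (z x) * (\<Sum>j\<in>J. l j x ^ (2 * m) * (a j \<bullet> y)\<^sup>2) -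
       (real (2 * m + 2))\<^sup>2 * ?V (z x) * (\<Sum>j\<in>J. l j x ^ (2 * m + 1) * (a j \<bullet> y))\<^sup>2)"
    using hessian_composite[where T="root_trunc \<alpha> K" and U="?U" and V="?V" and A=A and J=J
        and a=a and b=b and m=m and C=C, OF DERIV_root_trunc DERIV_root_trunc']
    unfolding l_def z_def by blast
  have eq: "y \<bullet> (H x *v y) = (A * N\<^sup>2 * (real K * root_coeff \<alpha> K)) * (Q x y * z x ^ (K - 1)) +
      (A * N\<^sup>2 / 2) * (\<Sum>i<K. (root_coeff \<alpha> i * real i) * (W x y * z x ^ (i - 1)))" for x y
  proof -
    define S where "S = (\<Sum>j\<in>J. l j x ^ (2 * m + 1) * (a j \<bullet> y))"
    have Q: "(\<Sum>j\<in>J. l j x ^ (2 * m) * (a j \<bullet> y)\<^sup>2) = Q x y"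
      unfolding Q_def by (simp add: power_mult_distrib power_even_eq)
    have "(\<Sum>j\<in>J. (l j x ^ Suc m)\<^sup>2) = 1 - z x"
    proof -
      have "(t ^ Suc m)\<^sup>2 = t ^ (2 * m + 2)" for t :: real
        unfolding power_mult[symmetric] by (rule arg_cong[where f="(^) t"]) simp
      then show ?thesis by (simp add: z_def)
    qed
    moreover have "(\<Sum>j\<in>J. l j x ^ Suc m * (l j x ^ m * (a j \<bullet> y))) = S"
      unfolding S_def by (rule sum.cong) (simp_all add: mult_2 power_add mult.assoc)
    ultimately have W: "(1 - z x) * Q x y - S\<^sup>2 = 1 / 2 * W x y"
      using lagrange_identity[where J=J and u="\<lambda>j. l j x ^ Suc m" and v="\<lambda>j. l j x ^ m * (a j \<bullet> y)"]
      unfolding Q_def W_def by simp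
    have "y \<bullet> (H x *v y) = A * (N * (N - 1) * ?U (z x) * Q x y - N\<^sup>2 * ?V (z x) * S\<^sup>2)"
      unfolding H(2) Q S_def[symmetric] by (simp add: N_def)
    also have "\<dots> = A * N\<^sup>2 * (((1 - \<alpha>) * ?U (z x)) * Q x y - ?V (z x) * S\<^sup>2)"
      using N by (simp add: \<alpha>_def power2_eq_square field_simps)
    also have "(1 - \<alpha>) * ?U (z x) = real K * root_coeff \<alpha> K * z x ^ (K - 1) + (1 - z x) * ?V (z x)"
      using root_trunc_ode[of \<alpha> K "z x"] by simp
    also have "\<dots> * Q x y - ?V (z x) * S\<^sup>2 =
        real K * root_coeff \<alpha> K * z x ^ (K - 1) * Q x y + ?V (z x) * ((1 - z x) * Q x y - S\<^sup>2)"
      by (simp add: algebra_simps)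
    also have "?V (z x) * ((1 - z x) * Q x y - S\<^sup>2) =
        1 / 2 * (\<Sum>i<K. (root_coeff \<alpha> i * real i) * (W x y * z x ^ (i - 1)))"
      unfolding W root_trunc''_def by (simp add: sum_distrib_left sum_distrib_right mult_ac)
    finally show ?thesis by (simp add: algebra_simps)
  qed
  have lpoly: "real_polynomial_function (l j)" for j
    unfolding l_def
    by (intro real_polynomial_function.intros(1-3) bounded_linear_inner_right)
  have lform: "y_form 0 (\<lambda>x y. l j x ^ i)" for i j
    using y_form_polynomial[OF real_polynomial_function_power[OF lpoly]] .
  have vform: "y_form 1 (\<lambda>x y. l j x ^ i * (a j \<bullet> y))" for i j
    using y_form_mult[OF lform y_form_inner, of j i "a j"] by simp
  have wform: "y_form 1 (\<lambda>x y. l i x ^ Suc m * (l j x ^ m * (a j \<bullet> y)))" for i j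
    using y_form_mult[OF lform vform, of i "Suc m" j m] by simp
  have Q: "sos_form 1 Q"
    unfolding Q_def[abs_def] by (intro sos_form_sum sos_form_square vform)
  have W: "sos_form 1 W"
    unfolding W_def[abs_def] by (intro sos_form_sum sos_form_square y_form_diff wform)
  have zpoly: "real_polynomial_function z"
    unfolding z_def
    by (intro real_polynomial_function_diff real_polynomial_function.intros(2)
        real_polynomial_function_sum real_polynomial_function_power lpoly assms)
  have zpow: "certified bl bu 0 (\<lambda>x y. z x ^ i)" for i
    by (rule certified_power[OF zpoly z])
  have mult: "certified bl bu 1 (\<lambda>x y. S x y * z x ^ i)" if "sos_form 1 S" for S i
    using certified_sos_mult[OF that zpow] by simp
  have "certified bl bu 1 (\<lambda>x y. y \<bullet> (H x *v y))"
    unfolding eq using \<alpha> N \<open>A \<ge> 0\<close>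
    by (intro certified_add certified_scale certified_sum mult Q W mult_nonneg_nonneg
        divide_nonneg_nonneg root_coeff_nonneg) auto
  with H(1) show ?thesis
    unfolding \<alpha>_def N_def by blast
qed

section \<open>Power norms of tangent planes\<close>

text \<open>Difference quotients of \<open>f\<close> from \<open>t\<close> towards \<open>x\<close> are at most \<open>f x - f t\<close> by convexity.
  Differentiability at \<open>t\<close> in the whole space covers boundary points of \<open>S\<close> and an \<open>S\<close> without interior.\<close>

lemma tangent_below_convex:
  fixes f :: "'a::real_inner \<Rightarrow> real"
  assumes "convex_on S f" "x \<in> S" "t \<in> S" "GDERIV f t :> g"
  shows "f t + (x - t) \<bullet> g \<le> f x"
proof -
  have "((\<lambda>h::real. f (t + h *\<^sub>R (x - t))) has_derivative (\<lambda>h. (h *\<^sub>R (x - t)) \<bullet> g)) (at 0)"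
  proof (rule has_derivative_compose[of "\<lambda>h. t + h *\<^sub>R (x - t)", where g=f])
    show "((\<lambda>h::real. t + h *\<^sub>R (x - t)) has_derivative (\<lambda>h. h *\<^sub>R (x - t))) (at 0)"
      by (auto intro!: derivative_eq_intros)
  qed (use assms(4) in \<open>simp add: gderiv_def\<close>)
  then have "((\<lambda>h. f (t + h *\<^sub>R (x - t))) has_real_derivative (x - t) \<bullet> g) (at 0)"
    by (simp add: has_field_derivative_def mult.commute[of _ "(x - t) \<bullet> g"])
  then have "((\<lambda>h. (f (t + h *\<^sub>R (x - t)) - f t) / h) \<longlongrightarrow> (x - t) \<bullet> g) (at 0)"
    by (simp add: DERIV_def)
  then have "((\<lambda>h. (f (t + h *\<^sub>R (x - t)) - f t) / h) \<longlongrightarrow> (x - t) \<bullet> g) (at_right 0)"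
    by (rule filterlim_mono) (auto simp: at_le)
  moreover have "eventually (\<lambda>h. (f (t + h *\<^sub>R (x - t)) - f t) / h \<le> f x - f t) (at_right (0::real))"
    using eventually_at_right_real[of 0 1]
  proof (rule eventually_mono)
    fix h :: real assume h: "h \<in> {0<..<1}"
    have "f ((1 - h) *\<^sub>R t + h *\<^sub>R x) \<le> (1 - h) * f t + h * f x"
      using h assms by (intro convex_onD[OF assms(1)]) auto
    moreover have "(1 - h) *\<^sub>R t + h *\<^sub>R x = t + h *\<^sub>R (x - t)"
      by (simp add: algebra_simps)
    ultimately show "(f (t + h *\<^sub>R (x - t)) - f t) / h \<le> f x - f t"
      using h by (simp add: field_simps)
  qed simp
  ultimately have "(x - t) \<bullet> g \<le> f x - f t"
    by (intro tendsto_upperbound) auto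
  then show ?thesis by simp
qed

text \<open>Each tangent plane exceeds \<open>f - \<epsilon>\<close> on an open neighbourhood of its base point, and finitely many of
  these neighbourhoods cover \<open>S\<close>.\<close>

lemma finitely_many_tangents:
  fixes f :: "'a::real_inner \<Rightarrow> real"
  assumes "compact S" "\<And>t. GDERIV f t :> g t" "\<epsilon> > 0"
  shows "\<exists>J. finite J \<and> J \<subseteq> S \<and> (\<forall>x\<in>S. \<exists>t\<in>J. f x - \<epsilon> \<le> f t + (x - t) \<bullet> g t)"
proof -
  define N where "N t = {x. f x - \<epsilon> < f t + (x - t) \<bullet> g t}" for t
  have cont: "continuous_on UNIV f"
    using assms(2) has_derivative_continuous
    by (fastforce simp: gderiv_def continuous_on_eq_continuous_within)
  have "open (N t)" for t
    unfolding N_def by (intro open_Collect_less continuous_intros cont)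
  moreover have "S \<subseteq> (\<Union>t\<in>S. N t)"
    using assms(3) by (auto simp: N_def)
  ultimately obtain J where "J \<subseteq> S" "finite J" "S \<subseteq> (\<Union>t\<in>J. N t)"
    using compactE_image[OF assms(1), of S N] by auto
  then show ?thesis
    by (intro exI[of _ J]) (force simp: N_def)
qed

text \<open>The factor \<open>card J powr (1 / N)\<close> tends to \<open>1\<close> as \<open>N\<close> grows, so for large \<open>N\<close> the power norm
  approximates the maximum uniformly as long as \<open>M\<close> stays bounded.\<close>

lemma power_mean_max:
  fixes l :: "'i \<Rightarrow> real"
  assumes "finite J" "j \<in> J" "N > 0" "\<And>i. i \<in> J \<Longrightarrow> 0 < l i \<and> l i \<le> M"
  shows "l j \<le> (\<Sum>i\<in>J. l i ^ N) powr (1 / N)"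
    "(\<Sum>i\<in>J. l i ^ N) powr (1 / N) \<le> real (card J) powr (1 / N) * M"
proof -
  have root: "(t ^ N) powr (1 / N) = t" if "t > 0" for t :: real
    using that assms(3) by (simp add: powr_realpow[symmetric] powr_powr)
  have pos: "0 < l j" "0 < M" using assms(2,4) by force+
  have "l j ^ N \<le> (\<Sum>i\<in>J. l i ^ N)"
    using assms by (intro member_le_sum) (auto simp: less_imp_le)
  then have "(l j ^ N) powr (1 / N) \<le> (\<Sum>i\<in>J. l i ^ N) powr (1 / N)"
    using pos by (intro powr_mono2) auto
  then show "l j \<le> (\<Sum>i\<in>J. l i ^ N) powr (1 / N)"
    using root[OF pos(1)] by simp
  have "(\<Sum>i\<in>J. l i ^ N) \<le> real (card J) * M ^ N"
    using assms by (intro sum_bounded_above power_mono) (auto simp: less_imp_le)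
  then have "(\<Sum>i\<in>J. l i ^ N) powr (1 / N) \<le> (real (card J) * M ^ N) powr (1 / N)"
    using assms by (intro powr_mono2 sum_nonneg) (auto simp: less_imp_le)
  then show "(\<Sum>i\<in>J. l i ^ N) powr (1 / N) \<le> real (card J) powr (1 / N) * M"
    using root[OF pos(2)] pos by (simp add: powr_mult)
qed

section \<open>Convexity and certificates from the Hessian\<close>

text \<open>Restriction to segments reduces this to functions on the unit interval, whatever the dimension of \<open>S\<close>.\<close>

lemma convex_on_hessian:
  fixes p :: "real ^ 'n::finite \<Rightarrow> real"
  assumes "convex S" "has_hessian p H" "\<And>x y. x \<in> S \<Longrightarrow> y \<bullet> (H x *v y) \<ge> 0"
  shows "convex_on S p"
proof (rule convex_onI)
  fix t :: real and x y assume t: "0 < t" "t < 1" and xy: "x \<in> S" "y \<in> S"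
  obtain g where g: "\<And>x. (p has_derivative (\<lambda>h. h \<bullet> g x)) (at x)"
    "\<And>x. (g has_derivative (\<lambda>h. H x *v h)) (at x)"
    using assms(2) unfolding has_hessian_def gderiv_def by blast
  define c where "c s = x + s *\<^sub>R (y - x)" for s :: real
  have c: "(c has_derivative (\<lambda>h. h *\<^sub>R (y - x))) (at s)" for s
    unfolding c_def by (auto intro!: derivative_eq_intros)
  have c_in: "c s \<in> S" if "s \<in> {0..1}" for s
  proof -
    have "c s = (1 - s) *\<^sub>R x + s *\<^sub>R y"
      by (simp add: c_def algebra_simps)
    then show ?thesis
      using that xy assms(1) by (auto intro!: convexD)
  qed
  have "convex_on {0..1} (\<lambda>s. p (c s))"
  proof (rule f''_ge0_imp_convex)
    show "((\<lambda>s. p (c s)) has_real_derivative (y - x) \<bullet> g (c s)) (at s)" for s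
      using has_derivative_compose[OF c g(1), of s]
      by (simp add: has_field_derivative_def mult.commute[of _ "(y - x) \<bullet> _"])
    show "((\<lambda>s. (y - x) \<bullet> g (c s)) has_real_derivative (y - x) \<bullet> (H (c s) *v (y - x))) (at s)" for s
      using has_derivative_inner_right[OF has_derivative_compose[OF c g(2)], of "y - x" s]
      by (simp add: has_field_derivative_def matrix_vector_mult_scaleR
          mult.commute[of _ "(y - x) \<bullet> _"])
    show "(y - x) \<bullet> (H (c s) *v (y - x)) \<ge> 0" if "s \<in> {0..1}" for s
      using assms(3)[OF c_in[OF that]] .
  qed simp
  from convex_onD[OF this, of t 0 1] t
  have "p (c t) \<le> (1 - t) * p (c 0) + t * p (c 1)" by simp
  then show "p ((1 - t) *\<^sub>R x + t *\<^sub>R y) \<le> (1 - t) * p x + t * p y"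
    by (simp add: c_def algebra_simps)
qed (rule assms(1))

lemma coord_box_eq_cbox:
  assumes "\<And>i. bl $ i \<le> bu $ i"
  shows "coord_box bl bu = cbox bl bu"
proof -
  have "(bu $ i - u) * (u - bl $ i) \<ge> 0 \<longleftrightarrow> bl $ i \<le> u \<and> u \<le> bu $ i" for i u
    using assms[of i] by (auto simp: zero_le_mult_iff)
  then show ?thesis
    by (auto simp: coord_box_def mem_box_cart)
qed

lemma sos_convexity_certificateI:
  assumes "has_hessian (poly_fun p) H" "certified bl bu 1 (\<lambda>x y. y \<bullet> (H x *v y))"
  shows "sos_convexity_certificate bl bu p"
proof -
  from assms(2) obtain F0 Fk where F: "sos_form 1 F0" "\<And>k. sos_form 1 (Fk k)"
    "(\<lambda>x y. y \<bullet> (H x *v y)) =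
      (\<lambda>x y. F0 x y + (\<Sum>k\<in>UNIV. Fk k x y * ((bu $ k - x $ k) * (x $ k - bl $ k))))"
    unfolding certified_def by blast
  from sos_form_representation[OF F(1)] obtain s0 where
    s0: "sum_of_squares s0" "quadratic_in_y s0" "poly_fun2 s0 = F0" by blast
  from sos_form_representation[OF F(2)] obtain s where
    s: "\<And>k. sum_of_squares (s k) \<and> quadratic_in_y (s k) \<and> poly_fun2 (s k) = Fk k" by metis
  show ?thesis
    unfolding sos_convexity_certificate_def
    using assms(1) s0 s fun_cong[OF fun_cong[OF F(3)]]
    by (intro exI[of _ H] exI[of _ s0] exI[of _ s]) simp
qed

section \<open>The approximating polynomial\<close>

text \<open>The Archimedean property bounds \<open>s = \<Sum> l\<^sub>j\<^sup>N\<close> by some \<open>R\<close> modulo the quadratic module. Dividing all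
  \<open>l\<^sub>j\<close> by \<open>A = R\<^bsup>1/N\<^esup>\<close> puts \<open>z = 1 - s / R\<close> into the module, and \<open>s\<^bsup>1/N\<^esup> = A (1 - z)\<^bsup>1/N\<^esup>\<close> is then
  approximated by the truncated series. The lower bound on one \<open>l\<^sub>j\<close> keeps \<open>z \<le> 1 - 1 / R\<close>,
  inside the disc of convergence.\<close>

lemma certified_power_norm_approximation:
  fixes a :: "'i \<Rightarrow> real ^ 'n::finite" and b :: "'i \<Rightarrow> real" and J :: "'i set" and m :: nat
  defines "l \<equiv> \<lambda>j x. a j \<bullet> x + b j"
  assumes "finite J" "j0 \<in> J" "\<And>x. x \<in> coord_box bl bu \<Longrightarrow> 1 \<le> l j0 x" "\<delta> > 0"
  shows "\<exists>p H. has_hessian (poly_fun p) H \<and> certified bl bu 1 (\<lambda>x y. y \<bullet> (H x *v y)) \<and>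
    (\<forall>x\<in>coord_box bl bu.
      \<bar>poly_fun p x - (C + (\<Sum>j\<in>J. l j x ^ (2 * m + 2)) powr (1 / real (2 * m + 2)))\<bar> \<le> \<delta>)"
proof -
  define N where "N = 2 * m + 2"
  define s where "s x = (\<Sum>j\<in>J. l j x ^ N)" for x
  have lN: "l j x ^ N \<ge> 0" for j x
    by (rule zero_le_even_power) (simp add: N_def)
  have lpoly: "real_polynomial_function (\<lambda>x. l j x ^ i)" for i j
    unfolding l_def
    by (intro real_polynomial_function.intros(1-3) real_polynomial_function_power
        bounded_linear_inner_right)
  have spoly: "real_polynomial_function s"
    unfolding s_def by (intro real_polynomial_function_sum lpoly assms)
  obtain D where D: "D \<ge> 0" "certified bl bu 0 (\<lambda>x y. D - (s x)\<^sup>2)"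
    using certified_bounded_polynomial[OF spoly] unfolding certified_bounded_def by blast
  \<comment> \<open>From a bound on \<open>s\<^sup>2\<close> to one on \<open>s\<close>: \<open>(D - s\<^sup>2) / 2 + (s - 1)\<^sup>2 / 2 = (D + 1) / 2 - s\<close>. Adding 1 ensures \<open>R \<ge> 1\<close>.\<close>
  define R where "R = (D + 1) / 2 + 1"
  have R: "R \<ge> 1" using D by (simp add: R_def)
  have "certified bl bu 0 (\<lambda>x y. (D - (s x)\<^sup>2) / 2 + ((s x - 1)\<^sup>2 / 2 + 1))"
  proof -
    have "sos_form 0 (\<lambda>x y. (1 / 2) * (s x - 1)\<^sup>2)"
      using sos_form_mult[OF sos_form_const[of "1 / 2"] sos_form_square[OF y_form_diff[OF
            y_form_polynomial[OF spoly] y_form_const[of 1]]]] by simp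
    from sos_form_add[OF this sos_form_const[of 1]]
    have "certified bl bu 0 (\<lambda>x y. (1 / 2) * (s x - 1)\<^sup>2 + 1)"
      by (intro certified_sos) simp
    from certified_add[OF certified_scale[OF _ D(2), of "1 / 2"] this]
    show ?thesis by simp
  qed
  moreover have "(D - t\<^sup>2) / 2 + ((t - 1)\<^sup>2 / 2 + 1) = R - t" for t
    by (simp add: R_def power2_eq_square field_simps)
  ultimately have Rs: "certified bl bu 0 (\<lambda>x y. R - s x)" by simp
  define A where "A = R powr (1 / N)"
  have A: "A > 0" "A ^ N = R"
  proof -
    show "A > 0" using R by (simp add: A_def)
    then have "A ^ N = A powr real N" by (simp add: powr_realpow)
    moreover have "N > 0" by (simp add: N_def)
    ultimately show "A ^ N = R" using R by (simp add: A_def powr_powr)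
  qed
  define z where "z x = 1 - (\<Sum>j\<in>J. ((1 / A) *\<^sub>R a j \<bullet> x + b j / A) ^ (2 * m + 2))" for x
  have z_eq: "z x = 1 - s x / R" for x
  proof -
    have "((1 / A) *\<^sub>R a j \<bullet> x + b j / A) ^ (2 * m + 2) = l j x ^ N / R" for j
      unfolding A(2)[symmetric] N_def l_def power_divide[symmetric]
      by (simp add: add_divide_distrib)
    then show ?thesis by (simp add: z_def s_def sum_divide_distrib)
  qed
  have "certified bl bu 0 (\<lambda>x y. (1 / R) * (R - s x))"
    using R by (intro certified_scale Rs) auto
  moreover have "(1 / R) * (R - s x) = z x" for x
    using R by (simp add: z_eq field_simps)
  ultimately have z: "certified bl bu 0 (\<lambda>x y. z x)" by simp
  have z_range: "z x \<in> {0..1 - 1 / R}" if x: "x \<in> coord_box bl bu" for x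
  proof -
    have "1 \<le> l j0 x ^ N" using assms(4)[OF x] by (rule one_le_power)
    also have "\<dots> \<le> s x"
      unfolding s_def using assms(2,3) lN by (intro member_le_sum) auto
    finally have "1 / R \<le> s x / R" using R by (intro divide_right_mono) auto
    then show ?thesis
      using certified_nonneg[OF z x] by (simp add: z_eq)
  qed
  obtain K where K: "\<And>z. z \<in> {0..1 - 1 / R} \<Longrightarrow>
      \<bar>root_trunc (1 / real N) K z - (1 - z) powr (1 / real N)\<bar> \<le> \<delta> / A"
  proof -
    have "0 \<le> 1 / real N" "1 / real N \<le> 1" "0 \<le> 1 - 1 / R" "1 - 1 / R < 1" "\<delta> / A > 0"
      using R A(1) assms(5) by (simp_all add: N_def)
    from root_trunc_approximates[OF this] that show ?thesis by blast
  qed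
  obtain H where H: "has_hessian (\<lambda>x. A * root_trunc (1 / real N) K (z x) + C) H"
    "certified bl bu 1 (\<lambda>x y. y \<bullet> (H x *v y))"
    using certified_hessian[where a="\<lambda>j. (1 / A) *\<^sub>R a j" and b="\<lambda>j. b j / A" and J=J and m=m
        and A=A and K=K and C=C, folded z_def, OF z assms(2)] A(1)
    unfolding N_def by (auto simp: less_imp_le)
  have "real_polynomial_function z"
  proof -
    have "z = (\<lambda>x. 1 - s x / R)" by (simp add: z_eq fun_eq_iff)
    then show ?thesis
      using spoly by (simp add: real_polynomial_function_diff real_polynomial_function_divide
          real_polynomial_function.intros(2))
  qed
  then have "real_polynomial_function (\<lambda>x. A * root_trunc (1 / real N) K (z x) + C)"
    unfolding root_trunc_def
    by (intro real_polynomial_function.intros(2-4) real_polynomial_function_diff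
        real_polynomial_function_sum real_polynomial_function_power) auto
  then obtain p where p: "poly_fun p = (\<lambda>x. A * root_trunc (1 / real N) K (z x) + C)"
    using poly_fun_representation by blast
  have "\<bar>poly_fun p x - (C + s x powr (1 / real N))\<bar> \<le> \<delta>" if x: "x \<in> coord_box bl bu" for x
  proof -
    have "A * (1 - z x) powr (1 / real N) = s x powr (1 / real N)"
    proof -
      have "s x \<ge> 0" unfolding s_def by (intro sum_nonneg lN)
      then show ?thesis using R by (simp add: z_eq A_def powr_divide)
    qed
    then have "poly_fun p x - (C + s x powr (1 / real N)) =
        A * (root_trunc (1 / real N) K (z x) - (1 - z x) powr (1 / real N))"
      by (simp add: p algebra_simps)
    then have "\<bar>poly_fun p x - (C + s x powr (1 / real N))\<bar> =
        A * \<bar>root_trunc (1 / real N) K (z x) - (1 - z x) powr (1 / real N)\<bar>"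
      using A(1) by (simp add: abs_mult)
    also have "\<dots> \<le> A * (\<delta> / A)"
      using A(1) K[OF z_range[OF x]] by (intro mult_left_mono) auto
    finally show ?thesis using A(1) by simp
  qed
  moreover have "has_hessian (poly_fun p) H"
    using H(1) by (simp only: p)
  ultimately show ?thesis
    using H(2) unfolding s_def N_def by blast
qed

theorem theorem8p4p6:
  fixes f :: "real ^ 'n::finite \<Rightarrow> real"
    and bl bu :: "real ^ 'n"
    and \<epsilon> :: real
  assumes "\<And>i. bl $ i \<le> bu $ i"
    and "C2_function f"
    and "convex_on (coord_box bl bu) f"
    and "\<epsilon> > 0"
  shows "\<exists>(d::nat) (p :: 'n rpoly).
           total_degree p = d \<and>
           (SUP x\<in>coord_box bl bu. \<bar>f x - poly_fun p x\<bar>) < \<epsilon> \<and>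
           convex_on (coord_box bl bu) (poly_fun p) \<and>
           sos_convexity_certificate bl bu p"
proof -
  let ?B = "coord_box bl bu"
  have B: "compact ?B" "convex ?B" "?B \<noteq> {}"
    unfolding coord_box_eq_cbox[OF assms(1)] using assms(1)
    by (auto simp: compact_cbox convex_box interval_ne_empty_cart)
  obtain g where g: "\<And>x. GDERIV f x :> g x"
    using assms(2) unfolding C2_function_def has_hessian_def by blast
  define \<delta> where "\<delta> = \<epsilon> / 4"
  have \<delta>: "\<delta> > 0" using assms(4) by (simp add: \<delta>_def)
  obtain J where J: "finite J" "J \<subseteq> ?B"
    "\<And>x. x \<in> ?B \<Longrightarrow> \<exists>t\<in>J. f x - \<delta> \<le> f t + (x - t) \<bullet> g t"
    using finitely_many_tangents[OF B(1) g \<delta>] by blast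
  obtain j0 where j0: "j0 \<in> J" using J(3) B(3) by blast
  have bdd: "\<exists>c. \<forall>t\<in>J. \<forall>x\<in>?B. \<bar>f t + (x - t) \<bullet> g t\<bar> \<le> c"
  proof -
    have "\<exists>c. \<forall>x\<in>?B. \<bar>f t + (x - t) \<bullet> g t\<bar> \<le> c" for t
    proof -
      have "bounded ((\<lambda>x. f t + (x - t) \<bullet> g t) ` ?B)"
        by (intro compact_imp_bounded compact_continuous_image B continuous_intros)
      then show ?thesis by (auto simp: bounded_iff)
    qed
    then obtain c where c: "\<And>t x. x \<in> ?B \<Longrightarrow> \<bar>f t + (x - t) \<bullet> g t\<bar> \<le> c t" by metis
    have "\<bar>f t + (x - t) \<bullet> g t\<bar> \<le> Max (c ` J)" if "t \<in> J" "x \<in> ?B" for t x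
    proof -
      have "c t \<le> Max (c ` J)" using J(1) that(1) by simp
      with c[OF that(2), of t] show ?thesis by linarith
    qed
    then show ?thesis by blast
  qed
  then obtain c where c: "\<And>t x. t \<in> J \<Longrightarrow> x \<in> ?B \<Longrightarrow> \<bar>f t + (x - t) \<bullet> g t\<bar> \<le> c"
    by blast
  \<comment> \<open>The shift by \<open>c + 1\<close> makes every tangent plane at least \<open>1\<close> on the box; it is undone in \<open>p\<close>.\<close>
  define b where "b t = f t - t \<bullet> g t + (c + 1)" for t
  have l_eq: "g t \<bullet> x + b t = f t + (x - t) \<bullet> g t + (c + 1)" for t x
    by (simp add: b_def inner_diff_left inner_commute[of "g t"])
  have l_ge: "1 \<le> g t \<bullet> x + b t" if "t \<in> J" "x \<in> ?B" for t x
    using c[OF that] by (simp add: l_eq)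
  have l_le: "g t \<bullet> x + b t \<le> f x + (c + 1)" if "t \<in> J" "x \<in> ?B" for t x
    using tangent_below_convex[OF assms(3) that(2) _ g, of t] J(2) that by (auto simp: l_eq)
  have f_le: "f x \<le> c + \<delta>" if "x \<in> ?B" for x
    using J(3)[OF that] c[OF _ that] by force
  \<comment> \<open>An upper bound for the shifted \<open>f\<close>: the factor \<open>1 + \<delta> / M\<close> then costs at most \<open>\<delta>\<close>.\<close>
  define M where "M = 2 * c + 1 + \<delta>"
  have M: "f x + (c + 1) \<le> M" if "x \<in> ?B" for x
    using f_le[OF that] by (simp add: M_def)
  have "M > 0"
    using c[OF j0] B(3) \<delta> by (force simp: M_def)
  have "(\<lambda>m. real (card J) powr (1 / real (2 * m + 2))) \<longlonglongrightarrow> 1"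
  proof -
    have "filterlim (\<lambda>m. 2 * m + 2 :: nat) at_top sequentially"
      by (rule filterlim_at_top_mono[OF filterlim_ident]) auto
    then have "(\<lambda>m. 1 / real (2 * m + 2)) \<longlonglongrightarrow> 0"
      by (rule filterlim_compose[OF lim_1_over_n])
    moreover have "real (card J) > 0" using J(1) j0 by (auto simp: card_gt_0_iff)
    ultimately show ?thesis
      using tendsto_powr[OF tendsto_const[of "real (card J)"], of _ 0] by fastforce
  qed
  then have "eventually (\<lambda>m. real (card J) powr (1 / real (2 * m + 2)) < 1 + \<delta> / M) sequentially"
    using \<delta> \<open>M > 0\<close> by (intro order_tendstoD(2)) auto
  then obtain m where m: "real (card J) powr (1 / real (2 * m + 2)) < 1 + \<delta> / M"
    by (auto simp: eventually_sequentially)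
  define s where "s x = (\<Sum>t\<in>J. (g t \<bullet> x + b t) ^ (2 * m + 2)) powr (1 / real (2 * m + 2))" for x
  have s: "\<bar>f x + (c + 1) - s x\<bar> \<le> \<delta>" if x: "x \<in> ?B" for x
  proof -
    have pos: "0 < g t \<bullet> x + b t \<and> g t \<bullet> x + b t \<le> f x + (c + 1)" if "t \<in> J" for t
      using l_ge[OF that x] l_le[OF that x] by simp
    obtain t where t: "t \<in> J" "f x - \<delta> \<le> f t + (x - t) \<bullet> g t" using J(3)[OF x] by blast
    have "f x + (c + 1) - \<delta> \<le> g t \<bullet> x + b t" using t(2) by (simp add: l_eq)
    also have "\<dots> \<le> s x"
      unfolding s_def
      by (rule power_mean_max(1)[where M="f x + (c + 1)" and l="\<lambda>t. g t \<bullet> x + b t"])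
        (use J(1) t(1) pos in auto)
    finally have lower: "f x + (c + 1) - \<delta> \<le> s x" .
    have "s x \<le> real (card J) powr (1 / real (2 * m + 2)) * (f x + (c + 1))"
      unfolding s_def
      by (rule power_mean_max(2)[where l="\<lambda>t. g t \<bullet> x + b t"]) (use J(1) t(1) pos in auto)
    also have "\<dots> \<le> (1 + \<delta> / M) * (f x + (c + 1))"
      using m pos[OF t(1)] by (intro mult_right_mono) auto
    also have "\<dots> \<le> f x + (c + 1) + \<delta> / M * M"
      using M[OF x] \<delta> \<open>M > 0\<close> by (simp add: distrib_right mult_left_mono del: times_divide_eq_left)
    finally show ?thesis using lower \<open>M > 0\<close> by simp
  qed
  obtain p H where p: "has_hessian (poly_fun p) H" "certified bl bu 1 (\<lambda>x y. y \<bullet> (H x *v y))"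
    "\<And>x. x \<in> ?B \<Longrightarrow> \<bar>poly_fun p x - (- (c + 1) + s x)\<bar> \<le> \<delta>"
    using certified_power_norm_approximation[OF J(1) j0, where a=g and b=b and bl=bl and bu=bu
        and \<delta>=\<delta> and C="- (c + 1)" and m=m] l_ge[OF j0] \<delta>
    unfolding s_def by blast
  have "(SUP x\<in>?B. \<bar>f x - poly_fun p x\<bar>) \<le> 2 * \<delta>"
  proof (rule cSUP_least[OF B(3)])
    show "\<bar>f x - poly_fun p x\<bar> \<le> 2 * \<delta>" if "x \<in> ?B" for x
      using s[OF that] p(3)[OF that] by linarith
  qed
  also have "\<dots> < \<epsilon>" using assms(4) by (simp add: \<delta>_def)
  finally have "(SUP x\<in>?B. \<bar>f x - poly_fun p x\<bar>) < \<epsilon>" .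
  moreover have "convex_on ?B (poly_fun p)"
    using B(2) p(1) certified_nonneg[OF p(2)] by (rule convex_on_hessian)
  moreover have "sos_convexity_certificate bl bu p"
    using p(1,2) by (rule sos_convexity_certificateI)
  ultimately show ?thesis by blast
qed

end
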